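(* Let $s\ge 2$, $t\ge 2$ and $n=s+t-1$. The graph $K^{s,t}_{n}$ is determined by its $D$-spectrum: every connected graph $D$-cospectral to $K^{s,t}_{n}$ is isomorphic to $K^{s,t}_{n}$.
   Context: All graphs are simple, undirected and connected. For a connected graph $G$, the distance matrix $D(G)$ has as $(i,j)$-entry the distance between the $i$-th and $j$-th vertices; its eigenvalues form the $D$-spectrum of $G$. Two graphs are $D$-cospectral if they have the same $D$-spectrum; $G$ is determined by its $D$-spectrum if every graph $D$-cospectral to $G$ is isomorphic to $G$. $K^{s,t}_{n}$ denotes the graph obtained from disjoint copies of $K_s$ and $K_t$ by identifying a vertex of $K_s$ with a vertex of $K_t$. *)

theory Defs
  imports "Jordan_Normal_Form.Char_Poly" "HOL-Library.Multiset"
begin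

text \<open>A (simple, undirected) graph on the vertex set {0..<n} is given by an
adjacency predicate adj; only its values on vertices below n matter.\<close>

definition simple_graph :: "nat \<Rightarrow> (nat \<Rightarrow> nat \<Rightarrow> bool) \<Rightarrow> bool" where
  "simple_graph n adj \<longleftrightarrow>
     (\<forall>i<n. \<not> adj i i) \<and> (\<forall>i<n. \<forall>j<n. adj i j \<longrightarrow> adj j i)"

definition edge_rel :: "nat \<Rightarrow> (nat \<Rightarrow> nat \<Rightarrow> bool) \<Rightarrow> (nat \<times> nat) set" where
  "edge_rel n adj = {(i, j). i < n \<and> j < n \<and> adj i j}"

definition connected_graph :: "nat \<Rightarrow> (nat \<Rightarrow> nat \<Rightarrow> bool) \<Rightarrow> bool" where
  "connected_graph n adj \<longleftrightarrow> (\<forall>i<n. \<forall>j<n. (i, j) \<in> (edge_rel n adj)\<^sup>*)"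

text \<open>Distance: length of a shortest walk (= shortest path) between i and j.\<close>
definition graph_dist :: "nat \<Rightarrow> (nat \<Rightarrow> nat \<Rightarrow> bool) \<Rightarrow> nat \<Rightarrow> nat \<Rightarrow> nat" where
  "graph_dist n adj i j = (LEAST k. (i, j) \<in> (edge_rel n adj) ^^ k)"

definition dist_matrix :: "nat \<Rightarrow> (nat \<Rightarrow> nat \<Rightarrow> bool) \<Rightarrow> real mat" where
  "dist_matrix n adj = mat n n (\<lambda>(i, j). real (graph_dist n adj i j))"

text \<open>D-spectrum: the multiset of eigenvalues of the (real symmetric) distance
matrix, counted with algebraic multiplicity, i.e. the multiset of roots of its
characteristic polynomial.\<close>
definition D_spectrum :: "nat \<Rightarrow> (nat \<Rightarrow> nat \<Rightarrow> bool) \<Rightarrow> real multiset" where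
  "D_spectrum n adj =
     (THE M. char_poly (dist_matrix n adj) = (\<Prod>a\<in>#M. [:- a, 1:]))"

definition D_cospectral ::
  "nat \<Rightarrow> (nat \<Rightarrow> nat \<Rightarrow> bool) \<Rightarrow> nat \<Rightarrow> (nat \<Rightarrow> nat \<Rightarrow> bool) \<Rightarrow> bool" where
  "D_cospectral n adj m adj' \<longleftrightarrow> D_spectrum n adj = D_spectrum m adj'"

definition graph_iso ::
  "nat \<Rightarrow> (nat \<Rightarrow> nat \<Rightarrow> bool) \<Rightarrow> nat \<Rightarrow> (nat \<Rightarrow> nat \<Rightarrow> bool) \<Rightarrow> bool" where
  "graph_iso n adj m adj' \<longleftrightarrow>
     (\<exists>f. bij_betw f {0..<n} {0..<m} \<and>
          (\<forall>i<n. \<forall>j<n. adj i j \<longleftrightarrow> adj' (f i) (f j)))"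

text \<open>K^{s,t}_n with n = s+t-1: K_s on {0..<s}, K_t on {s-1..<s+t-1},
sharing the vertex s-1.\<close>
definition Kst_adj :: "nat \<Rightarrow> nat \<Rightarrow> nat \<Rightarrow> nat \<Rightarrow> bool" where
  "Kst_adj s t i j \<longleftrightarrow> i \<noteq> j \<and>
     ((i < s \<and> j < s) \<or> (s - 1 \<le> i \<and> s - 1 \<le> j))"

end

(* Let M = D + I. For K^{s,t}_n the rows of M take only three values, so -1 has geometric, hence (D being
   symmetric) algebraic multiplicity at least n - 3. Therefore M has rank at most 3 for every D-cospectral
   graph as well, and any four rows of M are linearly dependent. Applied to the first four vertices of a
   geodesic this bounds the diameter by 2; applied to other quadruples it forbids enough induced
   subgraphs to force the complement to be a complete bipartite graph K_{p,q} plus isolated vertices.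
   The nonzero eigenvalues of M are then roots of x^3 - n x^2 - 3pq x + pq(n - p - q). For K^{s,t}_n
   this cubic has two distinct positive roots, and cubics of this shape sharing them agree in pq and in
   pq(n - p - q), which determines {p, q}. *)
theory Submission
  imports Defs "Jordan_Normal_Form.Jordan_Normal_Form_Existence"
    "Jordan_Normal_Form.Jordan_Normal_Form_Uniqueness" "Jordan_Normal_Form.DL_Rank"
begin

subsection \<open>Symmetric matrices and rank\<close>

text \<open>The Hermitian form \<open>q\<close> of an eigenvector is \<open>e\<close> times its
  squared norm \<open>s\<close>, and symmetry with real entries makes \<open>q\<close> its own
  conjugate. As \<open>s\<close> is positive, \<open>e\<close> is real.\<close>

lemma real_symmetric_complex_eigenvalue:
  fixes A :: "real mat"
  assumes A: "A \<in> carrier_mat n n" and sym: "\<And>i j. i < n \<Longrightarrow> j < n \<Longrightarrow> A $$ (i, j) = A $$ (j, i)"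
    and ev: "eigenvalue (map_mat complex_of_real A) e"
  shows "e \<in> \<real>"
proof -
  let ?I = "{0..<n}"
  obtain v where v: "v \<in> carrier_vec n" "v \<noteq> 0\<^sub>v n"
    and Av: "map_mat complex_of_real A *\<^sub>v v = e \<cdot>\<^sub>v v"
    using ev A unfolding eigenvalue_def eigenvector_def by auto
  have row: "(\<Sum>j\<in>?I. of_real (A $$ (i, j)) * v $ j) = e * v $ i" if "i < n" for i
    using arg_cong[OF Av, of "\<lambda>w. w $ i"] that A v(1)
    by (auto simp: mult_mat_vec_def scalar_prod_def)
  define q where "q = (\<Sum>i\<in>?I. \<Sum>j\<in>?I. of_real (A $$ (i, j)) * v $ j * cnj (v $ i))"
  define s where "s = (\<Sum>i\<in>?I. (cmod (v $ i))\<^sup>2)"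
  have "q = (\<Sum>i\<in>?I. e * v $ i * cnj (v $ i))"
    unfolding q_def by (intro sum.cong refl) (simp add: sum_distrib_right[symmetric] row)
  also have "\<dots> = e * of_real s"
    by (simp add: s_def sum_distrib_left mult.assoc complex_norm_square[symmetric])
  finally have q: "q = e * of_real s" .
  have "cnj q = (\<Sum>i\<in>?I. \<Sum>j\<in>?I. of_real (A $$ (i, j)) * cnj (v $ j) * v $ i)"
    by (simp add: q_def)
  also have "\<dots> = (\<Sum>j\<in>?I. \<Sum>i\<in>?I. of_real (A $$ (i, j)) * cnj (v $ j) * v $ i)"
    by (rule sum.swap)
  also have "\<dots> = q"
    unfolding q_def by (intro sum.cong refl) (simp add: sym mult_ac)
  finally have "cnj q = q" .
  obtain k where k: "k < n" "v $ k \<noteq> 0" using v by (metis carrier_vecD eq_vecI index_zero_vec)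
  have "(cmod (v $ k))\<^sup>2 \<le> s" unfolding s_def
    by (rule member_le_sum) (use k in auto)
  then have "s > 0" using k by (smt (verit) zero_less_norm_iff zero_less_power)
  then show ?thesis using q \<open>cnj q = q\<close> by (simp add: Reals_cnj_iff)
qed

text \<open>Over the complex numbers the polynomial splits, and its roots are eigenvalues, hence
  real. Replacing each root by its real part gives a real factorization with the same complex image,
  so coefficients can be compared.\<close>

lemma real_symmetric_char_poly_splits:
  fixes A :: "real mat"
  assumes A: "A \<in> carrier_mat n n" and sym: "\<And>i j. i < n \<Longrightarrow> j < n \<Longrightarrow> A $$ (i, j) = A $$ (j, i)"
  shows "\<exists>as. char_poly A = (\<Prod>a\<leftarrow>as. [:- a, 1:])"
proof -
  interpret of_real_poly: map_poly_comm_ring_hom complex_of_real ..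
  let ?B = "map_mat complex_of_real A"
  have B: "?B \<in> carrier_mat n n" using A by simp
  obtain as where as: "char_poly ?B = (\<Prod>a\<leftarrow>as. [:- a, 1:])"
    using char_poly_factorized[OF B] by blast
  have "of_real (Re a) = a" if "a \<in> set as" for a
  proof -
    have "poly (char_poly ?B) a = 0" unfolding as using that
      by (simp add: poly_prod_list prod_list_zero_iff image_iff o_def)
    then show ?thesis
      using real_symmetric_complex_eigenvalue[OF A sym] eigenvalue_root_char_poly[OF B] of_real_Re
      by blast
  qed
  then have "char_poly ?B = (\<Prod>a\<leftarrow>as. [:- of_real (Re a), 1:])"
    unfolding as by (metis (mono_tags, lifting) map_eq_conv)
  also have "\<dots> = map_poly of_real (\<Prod>a\<leftarrow>as. [:- Re a, 1:])"
    by (induction as) (simp_all add: of_real_poly.hom_mult of_real_hom.map_poly_pCons_hom del: mult_pCons_left)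
  finally have eq: "map_poly complex_of_real (char_poly A) = map_poly of_real (\<Prod>a\<leftarrow>as. [:- Re a, 1:])"
    by (simp only: of_real_hom.char_poly_hom[OF A])
  have "char_poly A = (\<Prod>a\<leftarrow>as. [:- Re a, 1:])"
  proof (rule poly_eqI)
    fix k
    show "coeff (char_poly A) k = coeff (\<Prod>a\<leftarrow>as. [:- Re a, 1:]) k"
      using arg_cong[OF eq, of "\<lambda>p. coeff p k"]
      by (simp only: of_real_hom.coeff_map_poly_hom of_real_eq_iff)
  qed
  then have "char_poly A = (\<Prod>a\<leftarrow>map Re as. [:- a, 1:])" by (simp add: o_def)
  then show ?thesis by blast
qed

text \<open>If \<open>C * C\<close> kills \<open>v\<close>, then
  \<open>C v \<bullet> C v = v \<bullet> C (C v) = 0\<close>, so \<open>C v = 0\<close>.\<close>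

lemma kernel_symmetric_square:
  fixes C :: "real mat"
  assumes C: "C \<in> carrier_mat n n" and sym: "C\<^sup>T = C"
  shows "mat_kernel (C * C) = mat_kernel C"
proof
  show "mat_kernel C \<subseteq> mat_kernel (C * C)" by (rule mat_kernel_mult_subset[OF C C])
  show "mat_kernel (C * C) \<subseteq> mat_kernel C"
  proof
    fix v assume "v \<in> mat_kernel (C * C)"
    then have v: "v \<in> carrier_vec n" and CC: "(C * C) *\<^sub>v v = 0\<^sub>v n"
      using mat_kernelD[of "C * C" n n v] C by auto
    have Cv: "C *\<^sub>v v \<in> carrier_vec n" using C v by auto
    have "(C *\<^sub>v v) \<bullet> (C *\<^sub>v v) = v \<bullet> (C *\<^sub>v (C *\<^sub>v v))"
      using transpose_vec_mult_scalar[OF C v Cv] sym comm_scalar_prod[of _ n v] C Cv v by simp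
    also have "\<dots> = 0" using CC v C by (simp add: assoc_mult_mat_vec)
    finally have "C *\<^sub>v v = 0\<^sub>v n"
      using conjugate_square_eq_0_vec[OF Cv] by (simp add: conjugate_vec_def map_vec_def)
    then show "v \<in> mat_kernel C" by (intro mat_kernelI[OF C v])
  qed
qed

text \<open>Algebraic and geometric multiplicity agree: since squaring the shifted matrix does not
  enlarge its kernel, no Jordan block for \<open>e\<close> has size above 1.\<close>

lemma symmetric_order_eq_kernel_dim:
  fixes A :: "real mat"
  assumes A: "A \<in> carrier_mat n n" and sym: "\<And>i j. i < n \<Longrightarrow> j < n \<Longrightarrow> A $$ (i, j) = A $$ (j, i)"
  shows "Polynomial.order e (char_poly A) = kernel_dim (char_matrix A e)"
proof -
  let ?C = "char_matrix A e"
  obtain as where "char_poly A = (\<Prod>a\<leftarrow>as. [:- a, 1:])"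
    using real_symmetric_char_poly_splits[OF A sym] by blast
  then obtain n_as where jnf: "jordan_nf A n_as" using jordan_nf_exists[OF A] by blast
  have C: "?C \<in> carrier_mat n n" using A by simp
  have symC: "?C\<^sup>T = ?C" using A sym by (intro eq_matI) (auto simp: char_matrix_def)
  have "kernel_dim (?C ^\<^sub>m 2) = kernel_dim ?C"
    using kernel_symmetric_square[OF C symC] C
    by (simp add: kernel_dim_def numeral_2_eq_2)
  then have "dim_gen_eigenspace A e 2 = dim_gen_eigenspace A e 1"
    using C by (simp add: dim_gen_eigenspace_def)
  then have eq: "(\<Sum>k\<leftarrow>map fst [(k, a)\<leftarrow>n_as. a = e]. min 2 k) = (\<Sum>k\<leftarrow>map fst [(k, a)\<leftarrow>n_as. a = e]. min 1 k)"
    unfolding dim_gen_eigenspace[OF jnf] .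
  \<comment> \<open>A block of size at least 2 adds 2 to the left sum and only 1 to the right one;
    no block can make up for that, as \<open>min 1 k\<close> never exceeds
    \<open>min 2 k\<close>.\<close>
  have "sum_list ks = (\<Sum>k\<leftarrow>ks. min 1 k)"
    if "(\<Sum>k\<leftarrow>ks. min 2 k) = (\<Sum>k\<leftarrow>ks. min 1 k)" for ks :: "nat list"
    using that
  proof (induction ks)
    case (Cons k ks)
    have "(\<Sum>k\<leftarrow>ks. min 1 k) \<le> (\<Sum>k\<leftarrow>ks. min 2 k)" by (rule sum_list_mono) simp
    then show ?case using Cons by (auto simp: min_def split: if_splits)
  qed simp
  from this[OF eq] have "sum_list (map fst [(k, a)\<leftarrow>n_as. a = e]) = dim_gen_eigenspace A e 1"
    unfolding dim_gen_eigenspace[OF jnf] .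
  moreover have "[(k, a)\<leftarrow>n_as. a = e] = filter (\<lambda>na. snd na = e) n_as"
    by (rule filter_cong) auto
  ultimately show ?thesis
    unfolding jordan_nf_order[OF jnf] using C by (simp add: dim_gen_eigenspace_def)
qed

section \<open>Rank, nullity and linear dependence of columns\<close>

lemma rank_plus_kernel_dim:
  fixes A :: "'a :: field mat"
  assumes A: "A \<in> carrier_mat n n"
  shows "vec_space.rank n A + kernel_dim A = n"
proof -
  interpret V: vec_space "TYPE('a)" n .
  interpret K: kernel n n A by unfold_locales (rule A)
  interpret L: linear_map "class_ring :: 'a ring" V.V V.V "\<lambda>v. A *\<^sub>v v"
    by unfold_locales (use A in \<open>auto simp: module_hom_def mult_add_distrib_mat_vec mult_mat_vec\<close>)
  have im: "L.im = V.col_space A"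
    using A by (auto simp: L.im_def V.col_space_eq[OF A])
  have ker: "L.ker = mat_kernel A"
    using A by (auto simp: L.ker_def mat_kernel[OF A])
  show ?thesis
    using L.rank_nullity[OF V.fin_dim] A
    by (simp add: im ker V.rank_def V.col_space_def V.dim_is_n kernel_dim_def)
qed

text \<open>The bound counts distinct columns, so a matrix with three column types has rank at most
  3. The rank is the size of a maximal independent set of columns.\<close>

lemma rank_le_card_cols:
  fixes A :: "'a :: field mat"
  assumes A: "A \<in> carrier_mat n nc"
  shows "vec_space.rank n A \<le> card (set (cols A))"
proof -
  interpret V: vec_space "TYPE('a)" n .
  obtain S where S: "maximal S (\<lambda>T. T \<subseteq> set (cols A) \<and> V.lin_indpt T)"
    using maximal_exists[of "\<lambda>T. T \<subseteq> set (cols A) \<and> V.lin_indpt T" "card (set (cols A))" "{}"]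
    by (meson List.finite_set card_mono empty_iff empty_subsetI V.finite_lin_indpt2 rev_finite_subset)
  then have "card S \<le> card (set (cols A))" by (simp add: card_mono maximal_def)
  then show ?thesis using V.rank_card_indpt[OF A S] by simp
qed

text \<open>Dependence is stated for an indexed family rather than a set of columns, so that
  repeated columns are covered and the relation can be read off entry by entry.\<close>

lemma low_rank_cols_dependent:
  fixes A :: "'a :: field mat" and x :: "'b \<Rightarrow> nat"
  assumes A: "A \<in> carrier_mat n nc" and fin: "finite I" and card: "vec_space.rank n A < card I"
    and x: "\<And>i. i \<in> I \<Longrightarrow> x i < nc"
  shows "\<exists>c. (\<exists>i\<in>I. c i \<noteq> 0) \<and> (\<forall>y<n. (\<Sum>i\<in>I. c i * A $$ (y, x i)) = 0)"
proof -
  interpret V: vec_space "TYPE('a)" n .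
  let ?f = "\<lambda>i. col A (x i)"
  show ?thesis
  proof (cases "inj_on ?f I")
    case True
    let ?U = "?f ` I"
    have sub: "?U \<subseteq> set (cols A)" using x A by (auto simp: cols_def)
    have cU: "?U \<subseteq> carrier_vec n" using A by auto
    have "card ?U > V.rank A" using card card_image[OF True] by simp
    then have ld: "V.lin_dep ?U" using V.rank_ge_card_indpt[OF A sub] by linarith
    obtain a w where a: "V.lincomb a ?U = 0\<^sub>v n" "w \<in> ?U" "a w \<noteq> 0"
      using V.finite_lin_dep[OF finite_imageI[OF fin] ld, unfolded module_vec_simps, OF cU] by blast
    have "(\<Sum>i\<in>I. a (?f i) * A $$ (y, x i)) = 0" if "y < n" for y
    proof -
      have "(\<Sum>u\<in>?U. a u * u $ y) = 0"
        unfolding V.lincomb_index[OF that cU, of a, symmetric] a(1) using that by simp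
      then have "(\<Sum>i\<in>I. a (?f i) * ?f i $ y) = 0"
        unfolding sum.reindex[OF True] o_def .
      moreover have "?f i $ y = A $$ (y, x i)" if "i \<in> I" for i
        using x[OF that] \<open>y < n\<close> A by (simp only: index_col carrier_matD)
      ultimately show ?thesis by (simp cong: sum.cong)
    qed
    moreover have "\<exists>i\<in>I. a (?f i) \<noteq> 0" using a(2,3) by blast
    ultimately show ?thesis by (intro exI[of _ "\<lambda>i. a (?f i)"] conjI allI impI)
  next
    case False
    then obtain i j where ij: "i \<in> I" "j \<in> I" "i \<noteq> j" "?f i = ?f j" by (auto simp: inj_on_def)
    \<comment> \<open>Two indices carry the same column, so the difference of their terms is a
      nontrivial relation.\<close>
    let ?c = "\<lambda>k. if k = i then 1 else if k = j then - 1 else (0::'a)"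
    have "(\<Sum>k\<in>I. ?c k * A $$ (y, x k)) = 0" if "y < n" for y
    proof -
      have "A $$ (y, x i) = A $$ (y, x j)"
        using arg_cong[OF ij(4), of "\<lambda>v. v $ y"] that A x[OF ij(1)] x[OF ij(2)]
        by (simp only: index_col carrier_matD)
      then have "(\<Sum>k\<in>{i, j}. ?c k * A $$ (y, x k)) = 0" using ij(3) by simp
      moreover have "(\<Sum>k\<in>{i, j}. ?c k * A $$ (y, x k)) = (\<Sum>k\<in>I. ?c k * A $$ (y, x k))"
        by (rule sum.mono_neutral_left) (use fin ij in auto)
      ultimately show ?thesis by (rule trans[OF sym, rotated])
    qed
    moreover have "?c i \<noteq> 0" by simp
    ultimately show ?thesis using ij(1) by (intro exI[of _ ?c] conjI bexI[of _ i] allI impI)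
  qed
qed

subsection \<open>Metrics whose matrix shifted by the identity has rank at most 3\<close>

text \<open>The last assumption says that \<open>D + I\<close> has rank at most 3.\<close>

locale rank3_metric =
  fixes V :: "'a set" and d :: "'a \<Rightarrow> 'a \<Rightarrow> nat"
  assumes zero_iff: "\<lbrakk>x \<in> V; y \<in> V\<rbrakk> \<Longrightarrow> d x y = 0 \<longleftrightarrow> x = y"
    and sym: "\<lbrakk>x \<in> V; y \<in> V\<rbrakk> \<Longrightarrow> d x y = d y x"
    and triangle: "\<lbrakk>x \<in> V; y \<in> V; z \<in> V\<rbrakk> \<Longrightarrow> d x z \<le> d x y + d y z"
    and geodesic: "\<lbrakk>x \<in> V; y \<in> V; d x y = Suc k\<rbrakk> \<Longrightarrow> \<exists>z\<in>V. d x z = k \<and> d z y = 1"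
    and dependent: "\<And>x :: nat \<Rightarrow> 'a. (\<And>i. i < 4 \<Longrightarrow> x i \<in> V) \<Longrightarrow>
      \<exists>c. (\<exists>i\<in>{..<4}. c i \<noteq> 0) \<and>
        (\<forall>y\<in>V. (\<Sum>i<4. c i * (real (d y (x i)) + (if y = x i then 1 else 0))) = 0)"
begin

text \<open>A relation among four columns, read in the four rows of the same points, is a kernel
  vector of a 4 by 4 principal submatrix of \<open>D + I\<close>. The nonsingularity of that
  submatrix is phrased as a linear system, which is plain linear arithmetic once the distances are
  numerals.\<close>

lemma quad:
  assumes V: "x0 \<in> V" "x1 \<in> V" "x2 \<in> V" "x3 \<in> V"
    and ne: "x0 \<noteq> x1" "x0 \<noteq> x2" "x0 \<noteq> x3" "x1 \<noteq> x2" "x1 \<noteq> x3" "x2 \<noteq> x3"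
    and d: "real (d x0 x1) = e01" "real (d x0 x2) = e02" "real (d x0 x3) = e03"
      "real (d x1 x2) = e12" "real (d x1 x3) = e13" "real (d x2 x3) = e23"
    and nonsingular: "\<And>c0 c1 c2 c3.
      \<lbrakk>c0 + e01 * c1 + e02 * c2 + e03 * c3 = 0; e01 * c0 + c1 + e12 * c2 + e13 * c3 = 0;
       e02 * c0 + e12 * c1 + c2 + e23 * c3 = 0; e03 * c0 + e13 * c1 + e23 * c2 + c3 = 0\<rbrakk>
      \<Longrightarrow> c0 = 0 \<and> c1 = 0 \<and> c2 = 0 \<and> c3 = 0"
  shows False
proof -
  let ?x = "\<lambda>i::nat. if i = 0 then x0 else if i = 1 then x1 else if i = 2 then x2 else x3"
  obtain c where c: "\<exists>i\<in>{..<4}. c i \<noteq> 0"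
      "\<forall>y\<in>V. (\<Sum>i<4. c i * (real (d y (?x i)) + (if y = ?x i then 1 else 0))) = 0"
    by (rule exE[OF dependent[of ?x]], use V in simp, elim conjE, rule that)
  have four: "{..<4::nat} = {0, 1, 2, 3}" by auto
  have sum4: "(\<Sum>i<4. f i) = f 0 + f 1 + f 2 + f (3::nat)" for f :: "nat \<Rightarrow> real"
    by (simp add: four)
  have eq: "c 0 * (real (d y x0) + (if y = x0 then 1 else 0)) + c 1 * (real (d y x1) + (if y = x1 then 1 else 0))
      + c 2 * (real (d y x2) + (if y = x2 then 1 else 0)) + c 3 * (real (d y x3) + (if y = x3 then 1 else 0)) = 0"
    if "y \<in> V" for y
    using c(2)[rule_format, OF that] unfolding sum4 by simp
  have diag: "d y y = 0" if "y \<in> V" for y using zero_iff that by blast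
  have flip: "d x1 x0 = d x0 x1" "d x2 x0 = d x0 x2" "d x3 x0 = d x0 x3"
      "d x2 x1 = d x1 x2" "d x3 x1 = d x1 x3" "d x3 x2 = d x2 x3"
    by (rule sym; fact V)+
  note entries = ne ne[THEN not_sym] flip d diag[OF V(1)] diag[OF V(2)] diag[OF V(3)] diag[OF V(4)]
  have "c 0 + e01 * c 1 + e02 * c 2 + e03 * c 3 = 0" using eq[OF V(1)]
    by (simp only: entries if_True if_False add_0_right add_0_left of_nat_0 mult_1_right simp_thms mult.commute)
  moreover have "e01 * c 0 + c 1 + e12 * c 2 + e13 * c 3 = 0" using eq[OF V(2)]
    by (simp only: entries if_True if_False add_0_right add_0_left of_nat_0 mult_1_right simp_thms mult.commute)
  moreover have "e02 * c 0 + e12 * c 1 + c 2 + e23 * c 3 = 0" using eq[OF V(3)]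
    by (simp only: entries if_True if_False add_0_right add_0_left of_nat_0 mult_1_right simp_thms mult.commute)
  moreover have "e03 * c 0 + e13 * c 1 + e23 * c 2 + c 3 = 0" using eq[OF V(4)]
    by (simp only: entries if_True if_False add_0_right add_0_left of_nat_0 mult_1_right simp_thms mult.commute)
  ultimately have "c 0 = 0 \<and> c 1 = 0 \<and> c 2 = 0 \<and> c 3 = 0" by (rule nonsingular)
  then show False using c(1) by (auto simp: four)
qed

lemma diameter_le_2:
  assumes "x \<in> V" "y \<in> V"
  shows "d x y \<le> 2"
proof (rule ccontr)
  assume "\<not> d x y \<le> 2"
  \<comment> \<open>Stepping back along geodesics from a point at distance above 2 lowers the
    distance by one each time, so the value 3 is met.\<close>
  then have "\<exists>y\<in>V. d x y = 3" using assms(2)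
  proof (induction "d x y" arbitrary: y)
    case (Suc k)
    then obtain z where z: "z \<in> V" "d x z = k" using geodesic assms(1) by metis
    show ?case
    proof (cases "k = 2")
      case True
      then show ?thesis using Suc by (intro bexI[of _ y]) auto
    next
      case False
      then show ?thesis using Suc z by (intro Suc(1)[of z]) auto
    qed
  qed simp
  then obtain w where w: "w \<in> V" "d x w = 3" by blast
  obtain v where v: "v \<in> V" "d x v = 2" "d v w = 1"
    using geodesic[OF assms(1) w(1), of 2] w(2) by auto
  obtain u where u: "u \<in> V" "d x u = 1" "d u v = 1"
    using geodesic[OF assms(1) v(1), of 1] v(2) by auto
  \<comment> \<open>At most 2 through \<open>v\<close>, and at least 3 - 1 because \<open>x\<close>
    and \<open>w\<close> are at distance 3. All six distances of the geodesic \<open>x\<close>,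
    \<open>u\<close>, \<open>v\<close>, \<open>w\<close> are then known.\<close>
  have uw: "d u w = 2"
    using triangle[OF u(1) v(1) w(1)] triangle[OF assms(1) u(1) w(1)] u v w by simp
  have ne: "x \<noteq> u" "x \<noteq> v" "x \<noteq> w" "u \<noteq> v" "u \<noteq> w" "v \<noteq> w"
    using u v w uw zero_iff assms(1) by force+
  show False
    by (rule quad[OF assms(1) u(1) v(1) w(1) ne, of 1 2 3 1 2 1]) (use u v w uw in auto)
qed

text \<open>As no distance exceeds 2, this is adjacency in the complement graph.\<close>

abbreviation far :: "'a \<Rightarrow> 'a \<Rightarrow> bool" where
  "far x y \<equiv> d x y = 2"

lemma far_commute: "\<lbrakk>x \<in> V; y \<in> V\<rbrakk> \<Longrightarrow> far x y \<longleftrightarrow> far y x"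
  using sym by metis

lemma far_neq: "\<lbrakk>x \<in> V; y \<in> V; far x y\<rbrakk> \<Longrightarrow> x \<noteq> y"
  using zero_iff by fastforce

lemma dist_eq: "\<lbrakk>x \<in> V; y \<in> V; x \<noteq> y\<rbrakk> \<Longrightarrow> d x y = (if far x y then 2 else 1)"
  using diameter_le_2[of x y] zero_iff[of x y] by auto

lemma near_eq: "\<lbrakk>x \<in> V; y \<in> V; x \<noteq> y; \<not> far x y\<rbrakk> \<Longrightarrow> d x y = 1"
  by (metis dist_eq)

text \<open>On an induced 4-vertex path of the complement, \<open>D + I\<close> is the all-ones
  matrix plus the adjacency matrix of the path, of determinant 3.\<close>

lemma no_far_path4:
  assumes "w \<in> V" "x \<in> V" "y \<in> V" "z \<in> V" "w \<noteq> y" "w \<noteq> z" "x \<noteq> z"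
    and "far w x" "far x y" "far y z" "\<not> far w y" "\<not> far x z" "\<not> far w z"
  shows False
proof -
  have ne: "w \<noteq> x" "x \<noteq> y" "y \<noteq> z" using assms far_neq by blast+
  show False
    by (rule quad[OF assms(1-4) ne(1) assms(5,6) ne(2) assms(7) ne(3), of 2 1 1 2 1 2])
      (use assms in \<open>simp_all add: near_eq\<close>)
qed

text \<open>For two disjoint edges of the complement the corresponding determinant is 5.\<close>

lemma no_far_2K2:
  assumes "w \<in> V" "x \<in> V" "y \<in> V" "z \<in> V" "w \<noteq> y" "w \<noteq> z" "x \<noteq> y" "x \<noteq> z"
    and "far w x" "far y z" "\<not> far w y" "\<not> far w z" "\<not> far x y" "\<not> far x z"
  shows False
proof -
  have ne: "w \<noteq> x" "y \<noteq> z" using assms far_neq by blast+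
  show False
    by (rule quad[OF assms(1-4) ne(1) assms(5-8) ne(2), of 2 1 1 1 1 2])
      (use assms in \<open>simp_all add: near_eq\<close>)
qed

text \<open>Otherwise the complement induces on the four points a triangle with a pendant edge at
  \<open>z\<close> (determinant 3) or a triangle with an isolated vertex (determinant 2).\<close>

lemma far_triangle_two:
  assumes "w \<in> V" "x \<in> V" "y \<in> V" "z \<in> V" "w \<noteq> x" "w \<noteq> y" "w \<noteq> z"
    and far: "far x y" "far y z" "far x z"
  shows "far w x \<or> far w y"
proof (rule ccontr)
  assume near: "\<not> ?thesis"
  have ne: "x \<noteq> y" "x \<noteq> z" "y \<noteq> z" using assms far_neq by blast+
  show False
  proof (cases "far w z")
    case True
    show ?thesis
      by (rule quad[OF assms(1-7) ne, of 1 1 2 2 2 2]) (use assms True near in \<open>simp_all add: near_eq\<close>)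
  next
    case False
    show ?thesis
      by (rule quad[OF assms(1-7) ne, of 1 1 1 2 2 2]) (use assms False near in \<open>simp_all add: near_eq\<close>)
  qed
qed

text \<open>The midpoint \<open>w\<close> of a geodesic from \<open>x\<close> to \<open>y\<close> is
  near both, hence different from \<open>z\<close>, which contradicts
  \<open>far_triangle_two\<close>.\<close>

lemma no_far_triangle:
  assumes V: "x \<in> V" "y \<in> V" "z \<in> V" and far: "far x y" "far y z" "far x z"
  shows False
proof -
  obtain w where w: "w \<in> V" "d x w = 1" "d w y = 1"
    using geodesic[OF V(1,2), of 1] far by auto
  have "d w x = 1" using w sym V by metis
  moreover have "w \<noteq> z" using w far by auto
  moreover have "w \<noteq> x" "w \<noteq> y" using w zero_iff V by (metis zero_neq_one)+
  ultimately show False using far_triangle_two[OF w(1) V _ _ _ far] w by auto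
qed

text \<open>A graph without triangles, induced 4-vertex paths and induced pairs of disjoint edges is
  complete bipartite up to isolated vertices. Given one edge between \<open>x\<close> and
  \<open>y\<close>, the parts are the neighbourhoods of its two ends; without edges both parts are
  empty.\<close>

lemma far_complete_bipartite:
  "\<exists>P Q. P \<subseteq> V \<and> Q \<subseteq> V \<and> P \<inter> Q = {} \<and>
     (\<forall>x\<in>V. \<forall>y\<in>V. far x y \<longleftrightarrow> (x \<in> P \<and> y \<in> Q) \<or> (x \<in> Q \<and> y \<in> P))"
proof (cases "\<exists>x\<in>V. \<exists>y\<in>V. far x y")
  case False
  then show ?thesis by (intro exI[of _ "{}"] conjI ballI) simp_all
next
  case True
  then obtain x y where xy: "x \<in> V" "y \<in> V" "far x y" by blast
  define P where "P = {v \<in> V. far v y}"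
  define Q where "Q = {v \<in> V. far v x}"
  have yx: "far y x" using xy(3) by (simp only: far_commute[OF xy(2,1)])
  have disj: "P \<inter> Q = {}"
  proof (rule ccontr)
    assume "P \<inter> Q \<noteq> {}"
    then obtain v where "v \<in> V" "far v y" "far v x" by (auto simp: P_def Q_def)
    then show False using no_far_triangle[of v x y] xy by simp
  qed
  \<comment> \<open>If \<open>u\<close> and \<open>v\<close> were near, then \<open>u\<close>,
    \<open>y\<close>, \<open>x\<close>, \<open>v\<close> would be an induced far path.\<close>
  have cross: "far u v" if "u \<in> P" "v \<in> Q" for u v
  proof (rule ccontr)
    assume n: "\<not> far u v"
    have u: "u \<in> V" "far u y" and v: "v \<in> V" "far v x" using that by (auto simp: P_def Q_def)
    have xv: "far x v" using v(2) by (simp only: far_commute[OF xy(1) v(1)])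
    have nu: "\<not> far u x" using that(1) disj u by (auto simp: P_def Q_def)
    have "\<not> far v y" using that(2) disj v by (auto simp: P_def Q_def)
    then have nv: "\<not> far y v" by (simp only: far_commute[OF xy(2) v(1)] not_False_eq_True)
    have ne: "u \<noteq> x" "y \<noteq> v" "u \<noteq> v" using n xv u nv yx nu v by auto
    show False
      by (rule no_far_path4[OF u(1) xy(2,1) v(1)]) (use ne u yx xv nu nv n in simp_all)
  qed
  have PQ: "u \<in> P \<and> v \<in> Q \<or> u \<in> Q \<and> v \<in> P" if uv: "u \<in> V" "v \<in> V" "far u v" for u v
  proof -
    \<comment> \<open>Suppose the end \<open>u\<close> of a far edge is far from neither
      \<open>x\<close> nor \<open>y\<close>. The other end \<open>v\<close> is far from at most one
      of them: from exactly one gives an induced path, from none gives two disjoint edges.\<close>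
    have touch: "u \<in> P \<union> Q" if uv: "u \<in> V" "v \<in> V" "far u v" for u v
    proof (rule ccontr)
      assume "u \<notin> P \<union> Q"
      then have n: "\<not> far u x" "\<not> far u y" using uv by (auto simp: P_def Q_def)
      then have ne: "u \<noteq> x" "u \<noteq> y" "v \<noteq> x" "v \<noteq> y" using xy yx uv by auto
      have nboth: "\<not> (far v x \<and> far v y)" using disj uv by (auto simp: P_def Q_def)
      consider "far v x" "\<not> far v y" | "far v y" "\<not> far v x" | "\<not> far v x" "\<not> far v y"
        using nboth by blast
      then show False
      proof cases
        case 1
        show False by (rule no_far_path4[OF uv(1,2) xy(1,2)]) (use n ne uv xy(3) 1 in simp_all)
      next
        case 2
        show False by (rule no_far_path4[OF uv(1,2) xy(2,1)]) (use n ne uv yx 2 in simp_all)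
      next
        case 3
        show False by (rule no_far_2K2[OF uv(1,2) xy(1,2)]) (use n ne uv xy(3) 3 in simp_all)
      qed
    qed
    have vu: "far v u" using uv(3) by (simp only: far_commute[OF uv(2,1)])
    have "u \<in> P \<union> Q" using touch[OF uv] .
    moreover have "v \<in> P \<union> Q" using touch[OF uv(2,1) vu] .
    \<comment> \<open>A far edge inside one part would form a triangle with \<open>y\<close>, or
      with \<open>x\<close> for the other part.\<close>
    moreover have "\<not> (u \<in> P \<and> v \<in> P)" using no_far_triangle[OF uv(1,2) xy(2) uv(3)] by (auto simp: P_def)
    moreover have "\<not> (u \<in> Q \<and> v \<in> Q)" using no_far_triangle[OF uv(1,2) xy(1) uv(3)] by (auto simp: Q_def)
    ultimately show ?thesis by blast
  qed
  have cross': "far u v" if "u \<in> Q" "v \<in> P" for u v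
  proof -
    have "u \<in> V" "v \<in> V" using that by (simp_all add: P_def Q_def)
    then show ?thesis using cross[OF that(2,1)] by (simp only: far_commute[of u v])
  qed
  have "P \<subseteq> V" "Q \<subseteq> V" by (auto simp: P_def Q_def)
  moreover have "\<forall>u\<in>V. \<forall>v\<in>V. far u v \<longleftrightarrow> (u \<in> P \<and> v \<in> Q) \<or> (u \<in> Q \<and> v \<in> P)"
    using cross cross' PQ by (intro ballI iffI) (assumption | elim disjE conjE | simp)+
  ultimately show ?thesis using disj by (intro exI[of _ P] exI[of _ Q] conjI)
qed

end

subsection \<open>Distance matrices and spectra\<close>

text \<open>The definite description is justified by uniqueness: \<open>proots\<close> recovers the
  multiset from the product of its linear factors.\<close>

lemma D_spectrum_eqI:
  assumes "char_poly (dist_matrix n adj) = (\<Prod>a\<in>#M. [:- a, 1:])"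
  shows "D_spectrum n adj = M"
proof -
  have roots: "proots (\<Prod>a\<in>#N. [:- a, 1:]) = N" for N :: "real multiset"
  proof (induction N)
    case (add x N)
    have "[:- x, 1:] * (\<Prod>a\<in>#N. [:- a, 1:]) \<noteq> 0"
      unfolding mult_eq_0_iff prod_mset_zero_iff by auto
    then have "[:- x, 1:] \<noteq> 0" "(\<Prod>a\<in>#N. [:- a, 1:]) \<noteq> 0" by auto
    from proots_mult[OF this] show ?case by (simp add: add.IH del: mult_pCons_left)
  qed simp
  show ?thesis
    unfolding D_spectrum_def using assms roots by (intro the_equality) metis+
qed

text \<open>Existence of the multiset comes from the splitting of real symmetric characteristic
  polynomials. Hence equal spectra give equal characteristic polynomials.\<close>

lemma char_poly_dist_matrix:
  assumes "\<And>i j. i < n \<Longrightarrow> j < n \<Longrightarrow> graph_dist n adj i j = graph_dist n adj j i"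
  shows "char_poly (dist_matrix n adj) = (\<Prod>a\<in>#D_spectrum n adj. [:- a, 1:])"
proof -
  have "dist_matrix n adj \<in> carrier_mat n n" by (simp add: dist_matrix_def)
  moreover have "dist_matrix n adj $$ (i, j) = dist_matrix n adj $$ (j, i)" if "i < n" "j < n" for i j
    using assms that by (simp add: dist_matrix_def)
  ultimately obtain as where "char_poly (dist_matrix n adj) = (\<Prod>a\<leftarrow>as. [:- a, 1:])"
    using real_symmetric_char_poly_splits by blast
  then have cp: "char_poly (dist_matrix n adj) = (\<Prod>a\<in>#mset as. [:- a, 1:])"
    by (simp add: mset_map[symmetric] prod_mset_prod_list del: mset_map)
  then show ?thesis using D_spectrum_eqI[OF cp] by simp
qed

section \<open>The graph distance as a metric with geodesics\<close>

lemma relpow_commute: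
  assumes "Relation.sym r"
  shows "(x, y) \<in> r ^^ k \<longleftrightarrow> (y, x) \<in> r ^^ k"
proof -
  have "(y, x) \<in> r ^^ k" if "(x, y) \<in> r ^^ k" for x y
    using that
  proof (induction k arbitrary: y)
    case (Suc k)
    then obtain z where "(x, z) \<in> r ^^ k" "(z, y) \<in> r" by (auto elim: relpow_Suc_E)
    then have "(y, z) \<in> r" "(z, x) \<in> r ^^ k" using Suc.IH assms by (auto dest: symD)
    then show ?case by (rule relpow_Suc_I2)
  qed simp
  then show ?thesis by blast
qed

lemma graph_dist_le: "(i, j) \<in> edge_rel n adj ^^ k \<Longrightarrow> graph_dist n adj i j \<le> k"
  unfolding graph_dist_def by (rule Least_le)

lemma graph_dist_walk:
  assumes "connected_graph n adj" "i < n" "j < n"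
  shows "(i, j) \<in> edge_rel n adj ^^ graph_dist n adj i j"
proof -
  have "\<exists>k. (i, j) \<in> edge_rel n adj ^^ k"
    using assms rtrancl_imp_relpow unfolding connected_graph_def by blast
  then show ?thesis unfolding graph_dist_def by (rule LeastI_ex)
qed

lemma graph_dist_commute:
  assumes "simple_graph n adj"
  shows "graph_dist n adj i j = graph_dist n adj j i"
proof -
  have "Relation.sym (edge_rel n adj)"
    using assms by (auto simp: Relation.sym_def edge_rel_def simple_graph_def)
  then show ?thesis unfolding graph_dist_def using relpow_commute by metis
qed

lemma graph_dist_triangle:
  assumes "connected_graph n adj" "i < n" "j < n" "k < n"
  shows "graph_dist n adj i k \<le> graph_dist n adj i j + graph_dist n adj j k"
  using graph_dist_walk[OF assms(1-3)] graph_dist_walk[OF assms(1,3,4)]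
  by (intro graph_dist_le) (auto simp: relpow_add)

lemma graph_dist_eq_0:
  assumes "connected_graph n adj" "i < n" "j < n"
  shows "graph_dist n adj i j = 0 \<longleftrightarrow> i = j"
  using graph_dist_walk[OF assms] graph_dist_le[of i j 0 n adj] by auto

lemma graph_dist_eq_1:
  assumes "connected_graph n adj" "simple_graph n adj" "i < n" "j < n"
  shows "graph_dist n adj i j = 1 \<longleftrightarrow> adj i j"
proof
  assume "graph_dist n adj i j = 1"
  then show "adj i j" using graph_dist_walk[OF assms(1,3,4)] by (auto simp: edge_rel_def)
next
  assume a: "adj i j"
  then have "graph_dist n adj i j \<le> 1" using assms by (intro graph_dist_le) (auto simp: edge_rel_def)
  moreover have "i \<noteq> j" using a assms by (auto simp: simple_graph_def)
  ultimately show "graph_dist n adj i j = 1" using graph_dist_eq_0[OF assms(1,3,4)] by linarith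
qed

text \<open>Take the last vertex but one of a shortest walk; by the triangle inequality neither part
  of the walk can be shortened.\<close>

lemma graph_dist_geodesic:
  assumes "connected_graph n adj" "i < n" "j < n" and d: "graph_dist n adj i j = Suc k"
  shows "\<exists>z<n. graph_dist n adj i z = k \<and> graph_dist n adj z j = 1"
proof -
  obtain z where z: "(i, z) \<in> edge_rel n adj ^^ k" "(z, j) \<in> edge_rel n adj"
    using graph_dist_walk[OF assms(1-3)] d by (auto elim: relpow_Suc_E)
  then have zn: "z < n" by (auto simp: edge_rel_def)
  have "graph_dist n adj i z \<le> k" "graph_dist n adj z j \<le> 1"
    using z by (auto intro: graph_dist_le)
  then show ?thesis using graph_dist_triangle[OF assms(1,2) zn assms(3)] d zn by (intro exI[of _ z]) linarith
qed

subsection \<open>Eigenvalues of matrices with two crossing blocks\<close>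

text \<open>For disjoint \<open>P\<close> and \<open>Q\<close> this is adjacency in the complete
  bipartite graph with these parts, all other points being isolated.\<close>

definition cross :: "'a set \<Rightarrow> 'a set \<Rightarrow> 'a \<Rightarrow> 'a \<Rightarrow> bool" where
  "cross P Q x y \<longleftrightarrow> x \<in> P \<and> y \<in> Q \<or> x \<in> Q \<and> y \<in> P"

text \<open>A row depends only on the block containing its index, so the product with
  \<open>v\<close> involves only three block sums.\<close>

lemma sum_cross:
  fixes v :: "'a \<Rightarrow> real"
  assumes "finite V" "P \<subseteq> V" "Q \<subseteq> V" "P \<inter> Q = {}"
  shows "(\<Sum>y\<in>V. (1 + of_bool (cross P Q x y)) * v y) =
    sum v V + of_bool (x \<in> P) * sum v Q + of_bool (x \<in> Q) * sum v P"
proof -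
  have "(\<Sum>y\<in>V. of_bool (y \<in> A) * v y) = sum v A" if "A \<subseteq> V" for A
    using that assms(1) by (simp add: of_bool_def if_distrib[of "\<lambda>c. c * _"] sum.If_cases inf.absorb2 cong: if_cong)
  note ind = this[OF assms(2)] this[OF assms(3)]
  have "(1 + of_bool (cross P Q x y)) * v y = v y + of_bool (x \<in> P) * (of_bool (y \<in> Q) * v y)
    + of_bool (x \<in> Q) * (of_bool (y \<in> P) * v y)" for y
    using assms(4) by (auto simp: cross_def)
  then show ?thesis by (simp add: sum.distrib sum_distrib_left[symmetric] ind)
qed

text \<open>The characteristic polynomial of the quotient of \<open>J\<close> plus the adjacency matrix of a
  complete bipartite graph by the partition into the parts, of sizes \<open>p\<close> and \<open>q\<close>, and the isolated
  vertices, \<open>n\<close> being the total number of vertices.\<close>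

definition cross_poly :: "real \<Rightarrow> real \<Rightarrow> real \<Rightarrow> real \<Rightarrow> real" where
  "cross_poly n p q \<mu> = \<mu> ^ 3 - n * \<mu>\<^sup>2 - 3 * (p * q) * \<mu> + p * q * (n - p - q)"

text \<open>Summing the eigenvector equation over \<open>P\<close>, \<open>Q\<close> and
  \<open>V\<close> gives a homogeneous 3 by 3 system for the block sums, with determinant
  \<open>cross_poly\<close> up to sign. The sums cannot all vanish, for then \<mu> v = 0 with \<mu>
  and v nonzero.\<close>

lemma cross_eigenvalue_root:
  fixes v :: "'a \<Rightarrow> real"
  assumes V: "finite V" "P \<subseteq> V" "Q \<subseteq> V" "P \<inter> Q = {}"
    and ev: "\<And>x. x \<in> V \<Longrightarrow> (\<Sum>y\<in>V. (1 + of_bool (cross P Q x y)) * v y) = \<mu> * v x"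
    and nz: "\<exists>x\<in>V. v x \<noteq> 0" and \<mu>: "\<mu> \<noteq> 0"
  shows "cross_poly (card V) (card P) (card Q) \<mu> = 0"
proof -
  let ?S = "sum v V" and ?p = "real (card P)" and ?q = "real (card Q)" and ?n = "real (card V)"
  have row: "\<mu> * v x = ?S + of_bool (x \<in> P) * sum v Q + of_bool (x \<in> Q) * sum v P" if "x \<in> V" for x
    using ev[OF that] sum_cross[OF V] by simp
  have P: "\<mu> * sum v P = ?p * (?S + sum v Q)"
  proof -
    have "\<mu> * v x = ?S + sum v Q" if "x \<in> P" for x
    proof -
      have "x \<in> V" "x \<notin> Q" using V that by auto
      then show ?thesis using row that by simp
    qed
    then have "\<mu> * sum v P = (\<Sum>x\<in>P. ?S + sum v Q)"
      unfolding sum_distrib_left by (rule sum.cong[OF refl])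
    then show ?thesis by simp
  qed
  have Q: "\<mu> * sum v Q = ?q * (?S + sum v P)"
  proof -
    have "\<mu> * v x = ?S + sum v P" if "x \<in> Q" for x
    proof -
      have "x \<in> V" "x \<notin> P" using V that by auto
      then show ?thesis using row that by simp
    qed
    then have "\<mu> * sum v Q = (\<Sum>x\<in>Q. ?S + sum v P)"
      unfolding sum_distrib_left by (rule sum.cong[OF refl])
    then show ?thesis by simp
  qed
  have S: "\<mu> * ?S = ?n * ?S + ?p * sum v Q + ?q * sum v P"
  proof -
    have "(\<Sum>x\<in>V. of_bool (x \<in> A) * c) = real (card A) * c" if "A \<subseteq> V" for A and c :: real
      using that V(1) by (simp add: of_bool_def if_distrib[of "\<lambda>a. a * _"] sum.If_cases inf.absorb2 cong: if_cong)
    note ind = this[OF V(2)] this[OF V(3)]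
    have "\<mu> * ?S = (\<Sum>x\<in>V. ?S + of_bool (x \<in> P) * sum v Q + of_bool (x \<in> Q) * sum v P)"
      by (subst sum_distrib_left) (rule sum.cong[OF refl row])
    then show ?thesis by (simp add: sum.distrib ind)
  qed
  obtain x where x: "x \<in> V" "v x \<noteq> 0" using nz by blast
  have "?S \<noteq> 0 \<or> sum v P \<noteq> 0 \<or> sum v Q \<noteq> 0"
    using row[OF x(1)] x(2) \<mu> by auto
  moreover have "cross_poly ?n ?p ?q \<mu> * ?S = 0 \<and> cross_poly ?n ?p ?q \<mu> * sum v P = 0 \<and>
    cross_poly ?n ?p ?q \<mu> * sum v Q = 0"
  proof -
    \<comment> \<open>The coefficients of \<open>e1\<close>, \<open>e2\<close>, \<open>e3\<close> are the cofactors of the linear system \<open>e1 = e2 = e3 = 0\<close>.\<close>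
    have cramer: "cross_poly n p q \<mu> * s = (\<mu>\<^sup>2 - p * q) * e3 + (q * \<mu> + p * q) * e1 + (p * \<mu> + p * q) * e2 \<and>
      cross_poly n p q \<mu> * a = (p * \<mu> + p * q) * e3 + ((\<mu> - n) * \<mu> - p * q) * e1 + (p * (\<mu> - n) + p\<^sup>2) * e2 \<and>
      cross_poly n p q \<mu> * b = (q * \<mu> + p * q) * e3 + (q * (\<mu> - n) + q\<^sup>2) * e1 + ((\<mu> - n) * \<mu> - p * q) * e2"
      if "e1 = \<mu> * a - p * (s + b)" "e2 = \<mu> * b - q * (s + a)" "e3 = (\<mu> - n) * s - p * b - q * a"
      for n p q s a b e1 e2 e3
      unfolding that cross_poly_def by (simp add: algebra_simps power2_eq_square power3_eq_cube)
    show ?thesis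
      using cramer[of 0 "sum v P" ?p ?S "sum v Q" 0 ?q 0 ?n] P Q S by (simp add: algebra_simps)
  qed
  ultimately show ?thesis by auto
qed

lemma cross_root_eigenvector:
  assumes V: "finite V" "P \<subseteq> V" "Q \<subseteq> V" "P \<inter> Q = {}" and n: "card V = card P + card Q + 1"
    and root: "cross_poly (card V) (card P) (card Q) \<mu> = 0" and \<mu>: "\<mu> > 0"
  shows "\<exists>v. (\<exists>x\<in>V. v x \<noteq> 0) \<and>
    (\<forall>x\<in>V. (\<Sum>y\<in>V. (1 + of_bool (cross P Q x y)) * v y) = \<mu> * v x)"
proof -
  let ?p = "real (card P)" and ?q = "real (card Q)"
  \<comment> \<open>Seek a vector with value x at the single point outside both parts, y on
    \<open>P\<close> and z on \<open>Q\<close>. The rows demand S = \<mu> x, S + q z = \<mu> y and S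
    + p y = \<mu> z for the total S. Solving for y and z and clearing the denominator gives these
    values; the row of the outside point is then exactly the cubic equation.\<close>
  let ?x = "\<mu>\<^sup>2 - ?p * ?q" and ?y = "\<mu>\<^sup>2 + \<mu> * ?q" and ?z = "\<mu>\<^sup>2 + \<mu> * ?p"
  define v where "v = (\<lambda>u. if u \<in> P then ?y else if u \<in> Q then ?z else ?x)"
  have fin: "finite P" "finite Q" using V by (auto intro: finite_subset)
  have sP: "sum v P = ?p * ?y" by (simp add: v_def)
  have sQ: "sum v Q = ?q * ?z"
  proof -
    have "sum v Q = (\<Sum>u\<in>Q. ?z)" using V(4) by (intro sum.cong) (auto simp: v_def)
    then show ?thesis by simp
  qed
  have "card (V - (P \<union> Q)) = 1"
    using card_Diff_subset[of "P \<union> Q" V] card_Un_disjoint[OF fin V(4)] V fin n by simp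
  then have "sum v (V - (P \<union> Q)) = ?x"
    by (auto simp: card_1_singleton_iff v_def)
  then have sV: "sum v V = ?x + ?p * ?y + ?q * ?z"
    using sum.subset_diff[of "P \<union> Q" V v] V fin sum.union_disjoint[OF fin V(4), of v] sP sQ by simp
  have f: "\<mu> ^ 3 - (?p + ?q + 1) * \<mu>\<^sup>2 - 3 * (?p * ?q) * \<mu> + ?p * ?q = 0"
    using root n by (simp add: cross_poly_def algebra_simps)
  have "(\<Sum>y\<in>V. (1 + of_bool (cross P Q x y)) * v y) = \<mu> * v x" if "x \<in> V" for x
  proof -
    have "sum v V = \<mu> * ?x"
      unfolding sV using f by (simp add: algebra_simps power2_eq_square power3_eq_cube)
    moreover have "\<mu> * ?x + ?q * ?z = \<mu> * ?y" "\<mu> * ?x + ?p * ?y = \<mu> * ?z"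
      by (simp_all add: algebra_simps power2_eq_square)
    ultimately show ?thesis
      unfolding sum_cross[OF V] sP sQ using V(4) by (auto simp: v_def)
  qed
  \<comment> \<open>The values on \<open>P\<close> and \<open>Q\<close> are positive; if both parts
    are empty, the remaining point has value \<open>\<mu>\<^sup>2\<close>.\<close>
  moreover have "\<exists>x\<in>V. v x \<noteq> 0"
  proof (rule ccontr)
    assume zero: "\<not> ?thesis"
    moreover have "?y > 0" "?z > 0" using \<mu> by (simp_all add: add_pos_nonneg)
    ultimately have "P = {}" "Q = {}" using V by (auto simp: v_def split: if_splits)
    then show False using zero \<mu> n V by (auto simp: v_def card_1_singleton_iff)
  qed
  ultimately show ?thesis by blast
qed

section \<open>Roots of the cubic and recovery of its parameters\<close>

lemma cross_poly_two_positive_roots: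
  assumes p: "p > 0" "q > 0"
  shows "\<exists>\<mu>\<^sub>1 \<mu>\<^sub>2. 0 < \<mu>\<^sub>1 \<and> \<mu>\<^sub>1 < \<mu>\<^sub>2 \<and>
    cross_poly (p + q + 1) p q \<mu>\<^sub>1 = 0 \<and> cross_poly (p + q + 1) p q \<mu>\<^sub>2 = 0"
proof -
  define n where "n = p + q + 1"
  define f where "f = cross_poly n p q"
  have pq: "p * q > 0" using p by simp
  have n: "n > 1" using p by (simp add: n_def)
  have f: "f \<mu> = \<mu>\<^sup>2 * (\<mu> - n) - 3 * (p * q) * \<mu> + p * q" for \<mu>
    by (simp add: f_def cross_poly_def n_def algebra_simps power2_eq_square power3_eq_cube)
  have cont: "continuous_on A f" for A unfolding f by (intro continuous_intros)
  \<comment> \<open>The cubic is positive at 0, negative at \<open>n\<close> and positive at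
    \<open>X\<close>, so it has one root on each side of \<open>n\<close>.\<close>
  have f0: "f 0 > 0" using pq by (simp add: f)
  have "f n = p * q * (1 - 3 * n)" by (simp add: f algebra_simps)
  then have fn: "f n < 0" using pq n by (simp add: mult_pos_neg)
  \<comment> \<open>With this choice \<open>X - n = 3 * (p * q)\<close>, and the first two terms of
    \<open>f X\<close> combine to \<open>3 * (p * q) * (X * (X - 1))\<close>.\<close>
  define X where "X = n + 3 * (p * q)"
  have X: "X > n" using pq by (simp add: X_def)
  have "f X = 3 * (p * q) * (X * (X - 1)) + p * q"
    unfolding f by (simp add: X_def algebra_simps power2_eq_square)
  then have fX: "f X > 0" using pq X n by (simp add: add_pos_pos)
  obtain a where a: "0 \<le> a" "a \<le> n" "f a = 0"
    using IVT2'[of f n 0 0] f0 fn n cont by force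
  obtain b where b: "n \<le> b" "b \<le> X" "f b = 0"
    using IVT'[of f n 0 X] fX fn X cont by force
  have "a \<noteq> 0" "a \<noteq> n" "b \<noteq> n" using a b f0 fn by auto
  then show ?thesis using a b unfolding f_def n_def by (intro exI[of _ a] exI[of _ b]) auto
qed

text \<open>With the same \<open>n\<close>, the difference of the two cubics has degree at most 1,
  and two distinct roots make it zero.\<close>

lemma cross_poly_eq_unique:
  assumes "\<mu>\<^sub>1 \<noteq> \<mu>\<^sub>2"
    and "cross_poly n p q \<mu>\<^sub>1 = 0" "cross_poly n p' q' \<mu>\<^sub>1 = 0"
    and "cross_poly n p q \<mu>\<^sub>2 = 0" "cross_poly n p' q' \<mu>\<^sub>2 = 0"
  shows "p * q = p' * q'" "p * q * (n - p - q) = p' * q' * (n - p' - q')"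
proof -
  have 1: "3 * (p * q - p' * q') * \<mu>\<^sub>1 = p * q * (n - p - q) - p' * q' * (n - p' - q')"
    using assms(2,3) unfolding cross_poly_def by (simp add: algebra_simps)
  have 2: "3 * (p * q - p' * q') * \<mu>\<^sub>2 = p * q * (n - p - q) - p' * q' * (n - p' - q')"
    using assms(4,5) unfolding cross_poly_def by (simp add: algebra_simps)
  have "3 * (p * q - p' * q') * \<mu>\<^sub>1 = 3 * (p * q - p' * q') * \<mu>\<^sub>2"
    by (rule trans[OF 1 2[symmetric]])
  then show eq: "p * q = p' * q'" using assms(1) by simp
  then show "p * q * (n - p - q) = p' * q' * (n - p' - q')" using 1 by simp
qed

text \<open>The hypothesis identifies \<open>D + I\<close> with the block matrix, whence the shift
  by 1. Eigenvectors become functions on indices, so that block sums apply.\<close>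

lemma eigenvalue_dist_matrix_iff:
  assumes d: "\<And>i j. i < n \<Longrightarrow> j < n \<Longrightarrow>
      real (graph_dist n adj i j) + of_bool (i = j) = 1 + of_bool (cross P Q i j)"
  shows "eigenvalue (dist_matrix n adj) (\<mu> - 1) \<longleftrightarrow>
    (\<exists>v. (\<exists>x\<in>{0..<n}. v x \<noteq> 0) \<and>
      (\<forall>x\<in>{0..<n}. (\<Sum>y\<in>{0..<n}. (1 + of_bool (cross P Q x y)) * v y) = \<mu> * v x))"
    (is "?L \<longleftrightarrow> (\<exists>v. ?N v \<and> ?R v)")
proof -
  let ?D = "dist_matrix n adj"
  have row: "(?D *\<^sub>v vec n v) $ x = (\<Sum>y\<in>{0..<n}. (1 + of_bool (cross P Q x y)) * v y) - v x"
    if "x < n" for x v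
  proof -
    have "(?D *\<^sub>v vec n v) $ x = (\<Sum>y\<in>{0..<n}. (1 + of_bool (cross P Q x y) - of_bool (x = y)) * v y)"
      using that by (auto simp: dist_matrix_def scalar_prod_def d[symmetric] intro!: sum.cong)
    also have "\<dots> = (\<Sum>y\<in>{0..<n}. (1 + of_bool (cross P Q x y)) * v y - (if y = x then v y else 0))"
      by (intro sum.cong) auto
    finally show ?thesis using that by (simp add: sum_subtractf)
  qed
  have R: "?R v \<longleftrightarrow> ?D *\<^sub>v vec n v = (\<mu> - 1) \<cdot>\<^sub>v vec n v" for v
  proof -
    have "?D *\<^sub>v vec n v = (\<mu> - 1) \<cdot>\<^sub>v vec n v \<longleftrightarrow>
        (\<forall>x<n. (?D *\<^sub>v vec n v) $ x = (\<mu> - 1) * v x)"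
      by (auto simp: vec_eq_iff dist_matrix_def)
    then show ?thesis using row by (auto simp: algebra_simps)
  qed
  have N: "?N v \<longleftrightarrow> vec n v \<noteq> 0\<^sub>v n" for v
    by (auto simp: vec_eq_iff)
  have D: "dim_row ?D = n" by (simp add: dist_matrix_def)
  show ?thesis
  proof
    assume ?L
    then obtain w where w: "w \<in> carrier_vec n" "w \<noteq> 0\<^sub>v n" "?D *\<^sub>v w = (\<mu> - 1) \<cdot>\<^sub>v w"
      unfolding eigenvalue_def eigenvector_def D by blast
    have "vec n (\<lambda>i. w $ i) = w" using w(1) by auto
    then show "\<exists>v. ?N v \<and> ?R v" using w unfolding N R by (intro exI[of _ "\<lambda>i. w $ i"]) simp
  next
    assume "\<exists>v. ?N v \<and> ?R v"
    then show ?L unfolding N R eigenvalue_def eigenvector_def D by (metis vec_carrier)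
  qed
qed

subsection \<open>Graphs whose complement is complete bipartite up to isolated vertices\<close>

text \<open>Glue bijections between the first blocks, the second blocks and the remainders, which
  also have equal size.\<close>

lemma bij_betw_two_blocks:
  assumes fin: "finite V" "finite V'" and card: "card V = card V'" "card P = card P'" "card Q = card Q'"
    and sub: "P \<subseteq> V" "Q \<subseteq> V" "P \<inter> Q = {}" "P' \<subseteq> V'" "Q' \<subseteq> V'" "P' \<inter> Q' = {}"
  shows "\<exists>f. bij_betw f V V' \<and> (\<forall>x\<in>V. (f x \<in> P' \<longleftrightarrow> x \<in> P) \<and> (f x \<in> Q' \<longleftrightarrow> x \<in> Q))"
proof -
  have finPQ: "finite P" "finite Q" "finite P'" "finite Q'"
    using fin sub by (auto intro: finite_subset)
  obtain g where g: "bij_betw g P P'" using finite_same_card_bij[OF finPQ(1,3) card(2)] by blast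
  obtain h where h: "bij_betw h Q Q'" using finite_same_card_bij[OF finPQ(2,4) card(3)] by blast
  have "card (V - (P \<union> Q)) = card (V' - (P' \<union> Q'))"
    using card_Diff_subset[of "P \<union> Q" V] card_Diff_subset[of "P' \<union> Q'" V'] sub finPQ card
      card_Un_disjoint[OF finPQ(1,2) sub(3)] card_Un_disjoint[OF finPQ(3,4) sub(6)] by simp
  then obtain k where k: "bij_betw k (V - (P \<union> Q)) (V' - (P' \<union> Q'))"
    using finite_same_card_bij fin by (metis finite_Diff)
  define f where "f = (\<lambda>x. if x \<in> P then g x else if x \<in> Q then h x else k x)"
  have fP: "bij_betw f P P'" using g by (rule bij_betw_cong[THEN iffD1, rotated]) (simp add: f_def)
  have fQ: "bij_betw f Q Q'"
    using h by (rule bij_betw_cong[THEN iffD1, rotated]) (use sub in \<open>auto simp: f_def\<close>)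
  have fR: "bij_betw f (V - (P \<union> Q)) (V' - (P' \<union> Q'))"
    using k by (rule bij_betw_cong[THEN iffD1, rotated]) (auto simp: f_def)
  have "bij_betw f ((P \<union> Q) \<union> (V - (P \<union> Q))) ((P' \<union> Q') \<union> (V' - (P' \<union> Q')))"
    using bij_betw_combine[OF bij_betw_combine[OF fP fQ sub(6)] fR] by auto
  then have "bij_betw f V V'" using sub by (simp add: Un_absorb1)
  moreover have "f x \<in> P' \<longleftrightarrow> x \<in> P" "f x \<in> Q' \<longleftrightarrow> x \<in> Q" if "x \<in> V" for x
    using that bij_betwE[OF fP] bij_betwE[OF fQ] bij_betwE[OF fR] sub by blast+
  ultimately show ?thesis by blast
qed

lemma cross_graph_iso:
  assumes adj: "\<And>i j. i < n \<Longrightarrow> j < n \<Longrightarrow> adj i j \<longleftrightarrow> i \<noteq> j \<and> \<not> cross P Q i j"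
    and adj': "\<And>i j. i < n \<Longrightarrow> j < n \<Longrightarrow> adj' i j \<longleftrightarrow> i \<noteq> j \<and> \<not> cross P' Q' i j"
    and sub: "P \<subseteq> {0..<n}" "Q \<subseteq> {0..<n}" "P \<inter> Q = {}" "P' \<subseteq> {0..<n}" "Q' \<subseteq> {0..<n}" "P' \<inter> Q' = {}"
    and card: "card P = card P'" "card Q = card Q'"
  shows "graph_iso n adj n adj'"
proof -
  obtain f where f: "bij_betw f {0..<n} {0..<n}"
    and blocks: "\<forall>x\<in>{0..<n}. (f x \<in> P' \<longleftrightarrow> x \<in> P) \<and> (f x \<in> Q' \<longleftrightarrow> x \<in> Q)"
    using bij_betw_two_blocks[OF finite_atLeastLessThan finite_atLeastLessThan refl card sub] by blast
  have "adj i j \<longleftrightarrow> adj' (f i) (f j)" if "i < n" "j < n" for i j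
  proof -
    have "f i < n" "f j < n" using bij_betwE[OF f] that by auto
    moreover have "f i = f j \<longleftrightarrow> i = j" using bij_betw_imp_inj_on[OF f] that by (auto simp: inj_on_eq_iff)
    moreover have "cross P' Q' (f i) (f j) \<longleftrightarrow> cross P Q i j" using blocks that by (simp add: cross_def)
    ultimately show ?thesis using adj adj' that by simp
  qed
  then show ?thesis unfolding graph_iso_def using f by blast
qed

section \<open>The rank of D + I and the shape of the complement\<close>

lemma char_matrix_dist_matrix:
  "i < n \<Longrightarrow> j < n \<Longrightarrow>
    char_matrix (dist_matrix n adj) (- 1) $$ (i, j) = real (graph_dist n adj i j) + of_bool (i = j)"
  by (simp add: char_matrix_def dist_matrix_def)

lemma rank_cross_dist_matrix_le:
  assumes d: "\<And>i j. i < n \<Longrightarrow> j < n \<Longrightarrow>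
      real (graph_dist n adj i j) + of_bool (i = j) = 1 + of_bool (cross P Q i j)"
    and disj: "P \<inter> Q = {}"
  shows "vec_space.rank n (char_matrix (dist_matrix n adj) (- 1)) \<le> 3"
proof -
  let ?M = "char_matrix (dist_matrix n adj) (- 1)"
  have M: "?M \<in> carrier_mat n n" by (simp add: dist_matrix_def)
  \<comment> \<open>The column of index \<open>j\<close>, where \<open>b\<close> and
    \<open>b'\<close> tell whether \<open>j\<close> lies in \<open>P\<close> and in
    \<open>Q\<close>. Disjointness excludes that both hold, which leaves three columns.\<close>
  define c where "c = (\<lambda>b b'. vec n (\<lambda>i. 1 + of_bool (i \<in> P \<and> b' \<or> i \<in> Q \<and> b) :: real))"
  have "col ?M j = c (j \<in> P) (j \<in> Q)" if "j < n" for j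
    using that M by (intro eq_vecI) (auto simp: c_def char_matrix_dist_matrix d cross_def)
  moreover have "c (j \<in> P) (j \<in> Q) \<in> {c True False, c False True, c False False}" for j
    using disj by (cases "j \<in> P"; cases "j \<in> Q") auto
  ultimately have "set (cols ?M) \<subseteq> {c True False, c False True, c False False}"
    using M by (auto simp: cols_def simp del: insert_iff)
  then have "card (set (cols ?M)) \<le> card {c True False, c False True, c False False}"
    by (rule card_mono[rotated]) simp
  also have "\<dots> \<le> 3" by (simp add: card_insert_if)
  finally show ?thesis using rank_le_card_cols[OF M] by simp
qed

lemma low_rank_graph_cross:
  assumes G: "simple_graph n adj" "connected_graph n adj"
    and rank: "vec_space.rank n (char_matrix (dist_matrix n adj) (- 1)) \<le> 3"
  obtains P Q where "P \<subseteq> {0..<n}" "Q \<subseteq> {0..<n}" "P \<inter> Q = {}"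
    and "\<And>i j. i < n \<Longrightarrow> j < n \<Longrightarrow> adj i j \<longleftrightarrow> i \<noteq> j \<and> \<not> cross P Q i j"
    and "\<And>i j. i < n \<Longrightarrow> j < n \<Longrightarrow>
      real (graph_dist n adj i j) + of_bool (i = j) = 1 + of_bool (cross P Q i j)"
proof -
  let ?M = "char_matrix (dist_matrix n adj) (- 1)"
  have M: "?M \<in> carrier_mat n n" by (simp add: dist_matrix_def)
  interpret rank3_metric "{0..<n}" "graph_dist n adj"
  proof
    fix x :: "nat \<Rightarrow> nat" assume x: "\<And>i. i < 4 \<Longrightarrow> x i \<in> {0..<n}"
    have "\<exists>c. (\<exists>i\<in>{..<4}. c i \<noteq> 0) \<and> (\<forall>y<n. (\<Sum>i<4. c i * ?M $$ (y, x i)) = 0)"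
      by (rule low_rank_cols_dependent[OF M]) (use rank x in auto)
    then obtain c where c: "\<exists>i\<in>{..<4}. c i \<noteq> 0" "\<And>y. y < n \<Longrightarrow> (\<Sum>i<4. c i * ?M $$ (y, x i)) = 0"
      by blast
    have "(\<Sum>i<4. c i * (real (graph_dist n adj y (x i)) + (if y = x i then 1 else 0))) = 0"
      if "y \<in> {0..<n}" for y
    proof -
      have "(\<Sum>i<4. c i * (real (graph_dist n adj y (x i)) + (if y = x i then 1 else 0))) =
          (\<Sum>i<4. c i * ?M $$ (y, x i))"
      proof (rule sum.cong[OF refl])
        fix i :: nat assume "i \<in> {..<4}"
        then have "x i < n" using x by simp
        then show "c i * (real (graph_dist n adj y (x i)) + (if y = x i then 1 else 0)) = c i * ?M $$ (y, x i)"
          using that by (simp add: char_matrix_dist_matrix)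
      qed
      then show ?thesis using c(2) that by simp
    qed
    with c(1) show "\<exists>c. (\<exists>i\<in>{..<4}. c i \<noteq> 0) \<and> (\<forall>y\<in>{0..<n}.
        (\<Sum>i<4. c i * (real (graph_dist n adj y (x i)) + (if y = x i then 1 else 0))) = 0)"
      by (intro exI[of _ c] conjI ballI)
  next
    fix x y k assume "x \<in> {0..<n}" "y \<in> {0..<n}" "graph_dist n adj x y = Suc k"
    then show "\<exists>z\<in>{0..<n}. graph_dist n adj x z = k \<and> graph_dist n adj z y = 1"
      using graph_dist_geodesic[OF G(2), of x y k] by auto
  qed (use G graph_dist_eq_0 graph_dist_commute graph_dist_triangle in auto)
  obtain P Q where PQ: "P \<subseteq> {0..<n}" "Q \<subseteq> {0..<n}" "P \<inter> Q = {}"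
    and far: "\<forall>x\<in>{0..<n}. \<forall>y\<in>{0..<n}. graph_dist n adj x y = 2 \<longleftrightarrow> x \<in> P \<and> y \<in> Q \<or> x \<in> Q \<and> y \<in> P"
    using far_complete_bipartite by blast
  have dist: "graph_dist n adj i j = (if i = j then 0 else if cross P Q i j then 2 else 1)"
    if "i < n" "j < n" for i j
    using far dist_eq[of i j] zero_iff[of i j] that by (cases "i = j") (simp_all add: cross_def)
  have "adj i j \<longleftrightarrow> i \<noteq> j \<and> \<not> cross P Q i j" if "i < n" "j < n" for i j
    using graph_dist_eq_1[OF G(2,1) that] dist[OF that] by (auto split: if_splits)
  moreover have "\<not> cross P Q i i" for i using PQ(3) by (auto simp: cross_def)
  then have "real (graph_dist n adj i j) + of_bool (i = j) = 1 + of_bool (cross P Q i j)"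
    if "i < n" "j < n" for i j
    using dist[OF that] by auto
  ultimately show thesis using that PQ by blast
qed

text \<open>The parts are the vertices private to each clique; the shared vertex
  \<open>s - 1\<close> lies in neither, so it is the one isolated vertex of the complement.\<close>

lemma Kst_adj_cross:
  assumes "s \<ge> 2" "t \<ge> 2" "n = s + t - 1" "i < n" "j < n"
  shows "Kst_adj s t i j \<longleftrightarrow> i \<noteq> j \<and> \<not> cross {0..<s - 1} {s..<n} i j"
  using assms by (auto simp: Kst_adj_def cross_def)

lemma graph_dist_Kst:
  assumes st: "s \<ge> 2" "t \<ge> 2" "n = s + t - 1" and ij: "i < n" "j < n"
  shows "graph_dist n (Kst_adj s t) i j =
    (if i = j then 0 else if cross {0..<s - 1} {s..<n} i j then 2 else 1)"
proof -
  let ?E = "edge_rel n (Kst_adj s t)"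
  note adj = Kst_adj_cross[OF st]
  have hub: "(k, s - 1) \<in> ?E" "(s - 1, k) \<in> ?E" if "k < n" "k \<noteq> s - 1" for k
    using that st by (auto simp: edge_rel_def Kst_adj_def)
  have simple: "simple_graph n (Kst_adj s t)"
    by (auto simp: simple_graph_def Kst_adj_def)
  have "(k, s - 1) \<in> ?E\<^sup>*" "(s - 1, k) \<in> ?E\<^sup>*" if "k < n" for k
    using hub[OF that] by (cases "k = s - 1"; blast)+
  then have conn: "connected_graph n (Kst_adj s t)"
    unfolding connected_graph_def by (meson rtrancl_trans)
  have two: "graph_dist n (Kst_adj s t) i j \<le> 2" if "cross {0..<s - 1} {s..<n} i j"
  proof (rule graph_dist_le)
    have "i \<noteq> s - 1" "j \<noteq> s - 1" using that st by (auto simp: cross_def)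
    then show "(i, j) \<in> ?E ^^ 2"
      using hub ij by (auto simp: numeral_2_eq_2)
  qed
  show ?thesis
    using graph_dist_eq_0[OF conn ij] graph_dist_eq_1[OF conn simple ij] adj[OF ij] two by auto
qed

text \<open>The multiplicity of \<open>e\<close> in the characteristic polynomial is the kernel
  dimension, and rank and kernel dimension add up to \<open>n\<close>.\<close>

lemma symmetric_rank_from_char_poly:
  fixes A B :: "real mat"
  assumes A: "A \<in> carrier_mat n n" "\<And>i j. i < n \<Longrightarrow> j < n \<Longrightarrow> A $$ (i, j) = A $$ (j, i)"
    and B: "B \<in> carrier_mat n n" "\<And>i j. i < n \<Longrightarrow> j < n \<Longrightarrow> B $$ (i, j) = B $$ (j, i)"
    and eq: "char_poly A = char_poly B"
  shows "vec_space.rank n (char_matrix A e) = vec_space.rank n (char_matrix B e)"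
proof -
  have "kernel_dim (char_matrix A e) = kernel_dim (char_matrix B e)"
    using symmetric_order_eq_kernel_dim[OF A] symmetric_order_eq_kernel_dim[OF B] eq by simp
  then show ?thesis
    using rank_plus_kernel_dim[OF char_matrix_closed[OF A(1), of e]]
      rank_plus_kernel_dim[OF char_matrix_closed[OF B(1), of e]] by simp
qed

section \<open>Recovery of the graph from its spectrum\<close>

theorem theorem3p5:
  fixes s t n m :: nat and adj :: "nat \<Rightarrow> nat \<Rightarrow> bool"
  assumes "s \<ge> 2" and "t \<ge> 2" and "n = s + t - 1"
    and "simple_graph m adj" and "connected_graph m adj"
    and "D_cospectral m adj n (Kst_adj s t)"
  shows "graph_iso m adj n (Kst_adj s t)"
proof -
  let ?K = "Kst_adj s t" and ?P' = "{0..<s - 1}" and ?Q' = "{s..<n}"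
  let ?a = "s - 1" and ?b = "t - 1"
  note st = assms(1-3)
  have commK: "graph_dist n ?K i j = graph_dist n ?K j i" if "i < n" "j < n" for i j
    using graph_dist_Kst[OF st] that by (auto simp: cross_def)
  have disj': "?P' \<inter> ?Q' = {}" and sub': "?P' \<subseteq> {0..<n}" "?Q' \<subseteq> {0..<n}" using st by auto
  have "\<not> cross ?P' ?Q' i i" for i using disj' by (auto simp: cross_def)
  then have dK: "real (graph_dist n ?K i j) + of_bool (i = j) = 1 + of_bool (cross ?P' ?Q' i j)"
    if "i < n" "j < n" for i j
    using graph_dist_Kst[OF st that] by auto
  have cp: "char_poly (dist_matrix m adj) = char_poly (dist_matrix n ?K)"
    using assms(6) char_poly_dist_matrix[of m adj] char_poly_dist_matrix[of n ?K]
      graph_dist_commute[OF assms(4)] commK by (simp add: D_cospectral_def)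
  have carrier: "dist_matrix k f \<in> carrier_mat k k" for k f by (simp add: dist_matrix_def)
  have "m = n"
    using degree_monic_char_poly[OF carrier, of m adj] degree_monic_char_poly[OF carrier, of n ?K] cp by simp
  note G = assms(4,5)[unfolded this] and cp = cp[unfolded this]
  have "vec_space.rank n (char_matrix (dist_matrix n adj) (- 1)) =
      vec_space.rank n (char_matrix (dist_matrix n ?K) (- 1))"
    by (rule symmetric_rank_from_char_poly[OF carrier _ carrier _ cp])
      (use graph_dist_commute[OF G(1)] commK in \<open>simp_all add: dist_matrix_def\<close>)
  also have "\<dots> \<le> 3" by (rule rank_cross_dist_matrix_le[OF dK disj'])
  finally obtain P Q where PQ: "P \<subseteq> {0..<n}" "Q \<subseteq> {0..<n}" "P \<inter> Q = {}"
    and adj: "\<And>i j. i < n \<Longrightarrow> j < n \<Longrightarrow> adj i j \<longleftrightarrow> i \<noteq> j \<and> \<not> cross P Q i j"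
    and d: "\<And>i j. i < n \<Longrightarrow> j < n \<Longrightarrow>
      real (graph_dist n adj i j) + of_bool (i = j) = 1 + of_bool (cross P Q i j)"
    using low_rank_graph_cross[OF G] by metis
  let ?p = "card P" and ?q = "card Q"
  have n: "n = ?a + ?b + 1" using st by simp
  have card': "card ?P' = ?a" "card ?Q' = ?b" using st by simp_all
  \<comment> \<open>A positive root of the cubic of \<open>?K\<close> yields an eigenvalue \<mu> - 1
    of \<open>?K\<close>, hence of the given graph, and hence a root of the cubic of that
    graph.\<close>
  have transfer: "cross_poly (real n) (real ?p) (real ?q) \<mu> = 0"
    if root: "cross_poly (real n) (real ?a) (real ?b) \<mu> = 0" and pos: "\<mu> > 0" for \<mu>
  proof -
    have "eigenvalue (dist_matrix n ?K) (\<mu> - 1)"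
      by (rule iffD2[OF eigenvalue_dist_matrix_iff], erule (1) dK,
          rule cross_root_eigenvector[OF _ sub' disj' _ _ pos]) (use root card' n in simp_all)
    then have "eigenvalue (dist_matrix n adj) (\<mu> - 1)"
      using cp eigenvalue_root_char_poly[OF carrier] by metis
    then obtain v where "\<exists>x\<in>{0..<n}. v x \<noteq> 0"
      "\<And>x. x \<in> {0..<n} \<Longrightarrow> (\<Sum>y\<in>{0..<n}. (1 + of_bool (cross P Q x y)) * v y) = \<mu> * v x"
      using iffD1[OF eigenvalue_dist_matrix_iff[of n adj P Q \<mu>]] d by blast
    then show ?thesis
      using cross_eigenvalue_root[OF _ PQ, of v \<mu>] pos by simp
  qed
  have nr: "real n = real ?a + real ?b + 1" using n by linarith
  obtain \<mu>\<^sub>1 \<mu>\<^sub>2 where \<mu>: "0 < \<mu>\<^sub>1" "\<mu>\<^sub>1 < \<mu>\<^sub>2"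
    "cross_poly (real n) (real ?a) (real ?b) \<mu>\<^sub>1 = 0" "cross_poly (real n) (real ?a) (real ?b) \<mu>\<^sub>2 = 0"
    using cross_poly_two_positive_roots[of "real ?a" "real ?b"] st unfolding nr by auto
  have ne: "\<mu>\<^sub>1 \<noteq> \<mu>\<^sub>2" using \<mu>(2) by simp
  have \<mu>2: "\<mu>\<^sub>2 > 0" using \<mu>(1,2) by simp
  note uniq = cross_poly_eq_unique[OF ne transfer[OF \<mu>(3,1)] \<mu>(3) transfer[OF \<mu>(4) \<mu>2] \<mu>(4)]
  \<comment> \<open>Cancelling the nonzero product in the equality of constant terms shows that the
    complement of the given graph also has exactly one isolated vertex.\<close>
  have "real ?a * real ?b \<noteq> 0" using st by simp
  moreover have "real ?a * real ?b * (real n - real ?p - real ?q) = real ?a * real ?b * 1"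
    using uniq(2) unfolding uniq(1) nr by simp
  ultimately have "real n - real ?p - real ?q = 1" by (rule mult_left_cancel[THEN iffD1])
  then have sum: "real ?q = real ?a + real ?b - real ?p" using nr by simp
  \<comment> \<open>The pairs have equal sum and equal product, so they agree up to order.\<close>
  have "(real ?p - real ?a) * (real ?p - real ?b) = 0"
    using uniq(1) unfolding sum by (simp add: algebra_simps)
  then consider "?p = ?a" "?q = ?b" | "?p = ?b" "?q = ?a"
    using sum by fastforce
  then have "graph_iso n adj n ?K"
  proof cases
    case 1
    then show ?thesis
      using cross_graph_iso[OF adj Kst_adj_cross[OF st] PQ sub' disj'] card' by simp
  next
    case 2
    \<comment> \<open>The relation \<open>cross\<close> is symmetric in its two parts, so they may
      be exchanged to match the sizes.\<close>
    have "adj i j \<longleftrightarrow> i \<noteq> j \<and> \<not> cross Q P i j" if "i < n" "j < n" for i j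
      using adj[OF that] by (auto simp: cross_def)
    moreover have "Q \<inter> P = {}" using PQ(3) by blast
    ultimately show ?thesis
      using cross_graph_iso[OF _ Kst_adj_cross[OF st] PQ(2,1) _ sub' disj', of adj] 2 card' by simp
  qed
  then show ?thesis using \<open>m = n\<close> by simp
qed

end
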